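(* Let $\mathbb{O}_s$ be the split-octonion algebra, $p\mathbb{O}_s$ the split-paraoctonion algebra and $\mathcal{O}_s$ the split-Okubo algebra over $\mathbb{R}$. Let $\mathbb{O}_sP^2$, $p\mathbb{O}_sP^2$ and $\mathcal{O}_sP^2$ be the incidence planes defined from Veronese vectors over these algebras with parameters $(\gamma_1,\gamma_2,\gamma_3)=(1,1,1)$. Then these three incidence planes are isomorphic: $$\mathcal{O}_sP^2\cong p\mathbb{O}_sP^2\cong \mathbb{O}_sP^2 .$$
   Context: **Octonions and split-octonions.** Let $\mathbb{O}$ be the real octonion algebra with basis $e_0=1,e_1,\dots,e_7$, where $e_k^2=-1$ for $k\ge 1$, distinct imaginary units anticommute, and $e_ie_{i+1}=e_{i+3}$, $e_{i+1}e_{i+3}=e_i$, $e_{i+3}e_i=e_{i+1}$ (indices in $\{1,\dots,7\}$ modulo $7$). The split-octonion algebra $\mathbb{O}_s$ is the real subalgebra of $\mathbb{C}\otimes_{\mathbb{R}}\mathbb{O}$ with real basis $f_k=e_k$ for $k\in\{0,1,3,7\}$ and $f_k=\sqrt{-1}\,e_k$ for $k\in\{2,4,5,6\}$. Its product is denoted $x\cdot y$. Conjugation $x\mapsto\overline{x}$ fixes $f_0=1$ and sends $f_k\mapsto -f_k$ for $k\geq1$. The norm $n$ is given by $n(x)1=x\cdot\overline{x}$; it has signature $(4,4)$ and is multiplicative. Write $\langle x,y\rangle=n(x+y)-n(x)-n(y)$. **Split-paraoctonions.** $p\mathbb{O}_s$ is the vector space $\mathbb{O}_s$ with the same norm $n$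 and the product $x\bullet y=\overline{x}\cdot\overline{y}$. **Split-Okubo algebra.** Let $\tau:\mathbb{O}_s\to\mathbb{O}_s$ be the order-three automorphism given by $\tau(f_k)=f_k$ for $k=0,1,3,7$ and $$\tau(f_2)=-\tfrac12(f_2-\sqrt3 f_5),\quad \tau(f_5)=-\tfrac12(f_5+\sqrt3 f_2),\quad \tau(f_4)=-\tfrac12(f_4-\sqrt3 f_6),\quad \tau(f_6)=-\tfrac12(f_6+\sqrt3 f_4).$$ $\mathcal{O}_s$ is the vector space $\mathbb{O}_s$ with the same norm $n$ and the product $x*y=\tau(\overline{x})\cdot\tau^2(\overline{y})$. **Veronese vectors** (for $(\gamma_1,\gamma_2,\gamma_3)=(1,1,1)$). For $\mathbb{K}$ one of these three algebras, let $V=\mathbb{K}^3\times\mathbb{R}^3$, with elements $(x_1,x_2,x_3;\lambda_1,\lambda_2,\lambda_3)$. - If $\mathbb{K}=\mathbb{O}_s$, a nonzero vector is Veronese if $\lambda_1\overline{x}_1=x_2\cdot x_3$, $\lambda_2\overline{x}_2=x_3\cdot x_1$, $\lambda_3\overline{x}_3=x_1\cdot x_2$ and $n(x_1)=\lambda_2\lambda_3$, $n(x_2)=\lambda_3\lambda_1$, $n(x_3)=\lambda_1\lambda_2$. - If $\mathbb{K}\in\{p\mathbb{O}_s,\mathcal{O}_s\}$ with product $\circ$ ($\circ=\bullet$ or $\circ=*$ respectively), a nonzero vector is Veronese if $\lambda_1x_1=x_2\circ x_3$, $\lambda_2x_2=x_3\circ x_1$, $\lambda_3x_3=x_1\circ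 x_2$ and $n(x_1)=\lambda_2\lambda_3$, $n(x_2)=\lambda_3\lambda_1$, $n(x_3)=\lambda_1\lambda_2$. **The incidence planes.** The points of $\mathbb{K}P^2$ are the one-dimensional subspaces $\mathbb{R}w\subset V$ with $w$ Veronese. The lines are the subspaces $w^\perp=\{z\in V:\beta(z,w)=0\}$ with $w$ Veronese, where for $x=(x_\nu;\lambda_\nu)_\nu$ and $y=(y_\nu;\mu_\nu)_\nu$, $$\beta(x,y)=\sum_{\nu=1}^3\big(\langle x_\nu,y_\nu\rangle+\lambda_\nu\mu_\nu\big).$$ A point is incident with a line iff it is contained in it. **Isomorphism.** An isomorphism of incidence planes is a pair of bijections, points to points and lines to lines, such that a point is incident with a line if and only if their images are incident. *)

theory Defs
  imports "HOL-Analysis.Analysis"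
begin

text \<open>
  Octonions over a commutative ring, as coordinate vectors with respect to
  \<open>e\<^sub>0 = 1, e\<^sub>1, \<dots>, e\<^sub>7\<close>; the coordinates are indexed by the numeral type \<open>8\<close>,
  whose elements are \<open>0, \<dots>, 7\<close>. Over \<open>real\<close> this is \<open>\<O>\<close>, and over
  \<open>complex\<close> it is \<open>\<C> \<otimes> \<O>\<close> with \<open>\<C>\<close>-basis \<open>1 \<otimes> e\<^sub>k\<close>.
\<close>

text \<open>The triples \<open>(i, i+1, i+3)\<close>, reduced modulo 7 to representatives in \<open>{1..7}\<close>.\<close>

definition oct_lines :: "(8 \<times> 8 \<times> 8) set" where
  "oct_lines = {(1,2,4), (2,3,5), (3,4,6), (4,5,7), (5,6,1), (6,7,2), (7,1,3)}"

definition oct_cyclic :: "8 \<Rightarrow> 8 \<Rightarrow> 8 \<Rightarrow> bool" where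
  "oct_cyclic i j k \<longleftrightarrow>
     (i, j, k) \<in> oct_lines \<or> (j, k, i) \<in> oct_lines \<or> (k, i, j) \<in> oct_lines"

text \<open>The coefficient of \<open>e\<^sub>k\<close> in \<open>e\<^sub>i e\<^sub>j\<close>.\<close>

definition oct_coeff :: "8 \<Rightarrow> 8 \<Rightarrow> 8 \<Rightarrow> 'a::comm_ring_1" where
  "oct_coeff i j k =
     (if i = 0 then (if k = j then 1 else 0)
      else if j = 0 then (if k = i then 1 else 0)
      else if i = j then (if k = 0 then - 1 else 0)
      else if oct_cyclic i j k then 1
      else if oct_cyclic j i k then - 1
      else 0)"

definition oct_mult :: "'a::comm_ring_1 ^ 8 \<Rightarrow> 'a ^ 8 \<Rightarrow> 'a ^ 8" where
  "oct_mult x y = (\<chi> k. \<Sum>i\<in>UNIV. \<Sum>j\<in>UNIV. oct_coeff i j k * x $ i * y $ j)"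

text \<open>
  A split octonion is given by its real coordinates with respect to \<open>f\<^sub>0, \<dots>, f\<^sub>7\<close>;
  \<open>split_emb\<close> is the inclusion into \<open>\<C> \<otimes> \<O>\<close>, and the product is the
  restriction of the product of \<open>\<C> \<otimes> \<O>\<close> along it (the range of \<open>split_emb\<close> is shown
  below to be closed under \<open>oct_mult\<close>).
\<close>

type_synonym split_oct = "real ^ 8"

abbreviation fb :: "8 \<Rightarrow> split_oct" where
  "fb k \<equiv> axis k 1"

definition split_basis :: "8 \<Rightarrow> complex ^ 8" where
  "split_basis k = axis k (if k \<in> {0, 1, 3, 7} then 1 else \<i>)"

definition split_emb :: "split_oct \<Rightarrow> complex ^ 8" where
  "split_emb x = (\<Sum>k\<in>UNIV. x $ k *\<^sub>R split_basis k)"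

definition split_mult :: "split_oct \<Rightarrow> split_oct \<Rightarrow> split_oct"  (infixl \<open>\<cdot>\<^sub>s\<close> 70) where
  "x \<cdot>\<^sub>s y = inv split_emb (oct_mult (split_emb x) (split_emb y))"

definition split_conj :: "split_oct \<Rightarrow> split_oct" where
  "split_conj x = (\<chi> k. if k = 0 then x $ k else - x $ k)"

definition split_norm :: "split_oct \<Rightarrow> real" where
  "split_norm x = (THE r. x \<cdot>\<^sub>s split_conj x = r *\<^sub>R fb 0)"

definition split_polar :: "split_oct \<Rightarrow> split_oct \<Rightarrow> real" where
  "split_polar x y = split_norm (x + y) - split_norm x - split_norm y"

definition para_mult :: "split_oct \<Rightarrow> split_oct \<Rightarrow> split_oct" where
  "para_mult x y = split_conj x \<cdot>\<^sub>s split_conj y"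

text \<open>The automorphism \<open>\<tau>\<close>, as the linear extension of its values on the basis.\<close>

definition tau_basis :: "8 \<Rightarrow> split_oct" where
  "tau_basis k =
     (if k = 2 then - (1/2) *\<^sub>R (fb 2 - sqrt 3 *\<^sub>R fb 5)
      else if k = 5 then - (1/2) *\<^sub>R (fb 5 + sqrt 3 *\<^sub>R fb 2)
      else if k = 4 then - (1/2) *\<^sub>R (fb 4 - sqrt 3 *\<^sub>R fb 6)
      else if k = 6 then - (1/2) *\<^sub>R (fb 6 + sqrt 3 *\<^sub>R fb 4)
      else fb k)"

definition tau :: "split_oct \<Rightarrow> split_oct" where
  "tau x = (\<Sum>k\<in>UNIV. x $ k *\<^sub>R tau_basis k)"

definition okubo_mult :: "split_oct \<Rightarrow> split_oct \<Rightarrow> split_oct" where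
  "okubo_mult x y = tau (split_conj x) \<cdot>\<^sub>s tau (tau (split_conj y))"


text \<open>
  Well-definedness: \<open>split_emb\<close> is injective, its range is closed under \<open>oct_mult\<close>,
  and \<open>x \<cdot>\<^sub>s split_conj x\<close> is a real multiple of \<open>fb 0\<close>.
\<close>

lemma split_emb_nth: "split_emb x $ k = of_real (x $ k) * (if k \<in> {0, 1, 3, 7} then 1 else \<i>)"
proof -
  have "split_emb x $ k = (\<Sum>j\<in>UNIV. x $ j *\<^sub>R split_basis j $ k)"
    unfolding split_emb_def sum_component vector_scaleR_component ..
  also have "\<dots> = (\<Sum>j\<in>UNIV. if j = k then of_real (x $ k) * (if k \<in> {0, 1, 3, 7} then 1 else \<i>) else 0)"
    by (intro sum.cong refl) (simp only: split_basis_def axis_def vec_lambda_beta scaleR_conv_of_real, simp)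
  finally show ?thesis by simp
qed

lemma inj_split_emb: "inj split_emb"
proof (rule injI)
  fix x y assume eq: "split_emb x = split_emb y"
  have "x $ k = y $ k" for k
  proof -
    have "split_emb x $ k = split_emb y $ k" using eq by simp
    then show ?thesis unfolding split_emb_nth by (cases "k \<in> {0, 1, 3, 7}") auto
  qed
  then show "x = y" by (simp add: vec_eq_iff)
qed

text \<open>The product in real coordinates.\<close>

definition split_prod :: "split_oct \<Rightarrow> split_oct \<Rightarrow> split_oct" where
  "split_prod x y = (\<chi> k. \<Sum>i\<in>UNIV. \<Sum>j\<in>UNIV. oct_coeff i j k * x $ i * y $ j *
     (if i \<notin> {0, 1, 3, 7} \<and> j \<notin> {0, 1, 3, 7} then - 1 else 1))"

lemma oct_cyclic_parity:
  assumes "oct_cyclic i j k"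
  shows "k \<in> {0, 1, 3, 7} \<longleftrightarrow> (i \<in> {0, 1, 3, 7} \<longleftrightarrow> j \<in> {0, 1, 3, 7})"
proof -
  define Q :: "8 \<Rightarrow> bool" where "Q a \<longleftrightarrow> a \<in> {0, 1, 3, 7}" for a
  have "\<forall>(a, b, c) \<in> oct_lines. Q c \<longleftrightarrow> (Q a \<longleftrightarrow> Q b)"
    unfolding oct_lines_def Q_def by simp
  then have "Q c \<longleftrightarrow> (Q a \<longleftrightarrow> Q b)" if "(a, b, c) \<in> oct_lines" for a b c
    using that by auto
  then have "Q k \<longleftrightarrow> (Q i \<longleftrightarrow> Q j)"
    using assms unfolding oct_cyclic_def by metis
  then show ?thesis unfolding Q_def .
qed

lemma oct_coeff_parity:
  assumes "oct_coeff i j k \<noteq> (0 :: 'a::comm_ring_1)"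
  shows "k \<in> {0, 1, 3, 7} \<longleftrightarrow> (i \<in> {0, 1, 3, 7} \<longleftrightarrow> j \<in> {0, 1, 3, 7})"
proof -
  consider "i = 0" "k = j" | "j = 0" "k = i" | "i = j" "k = 0" | "oct_cyclic i j k" | "oct_cyclic j i k"
    using assms unfolding oct_coeff_def by (simp split: if_splits)
  then show ?thesis
  proof cases
    case 4 then show ?thesis by (rule oct_cyclic_parity)
  next
    case 5 from oct_cyclic_parity[OF this] show ?thesis by argo
  qed simp_all
qed

lemma of_real_oct_coeff: "of_real (oct_coeff i j k) = oct_coeff i j k"
  by (simp add: oct_coeff_def)

lemma oct_mult_split_emb:
  "oct_mult (split_emb x) (split_emb y) = split_emb (split_prod x y)"
proof -
  define u :: "8 \<Rightarrow> complex" where "u k = (if k \<in> {0, 1, 3, 7} then 1 else \<i>)" for k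
  define s :: "8 \<Rightarrow> 8 \<Rightarrow> real" where
    "s i j = (if i \<notin> {0, 1, 3, 7} \<and> j \<notin> {0, 1, 3, 7} then - 1 else 1)" for i j
  have unit: "oct_coeff i j k * (u i * u j) = oct_coeff i j k * of_real (s i j) * u k" for i j k
  proof (cases "oct_coeff i j k = (0 :: complex)")
    case False
    from oct_coeff_parity[OF this] have "u i * u j = of_real (s i j) * u k"
      unfolding u_def s_def by (cases "i \<in> {0, 1, 3, 7}"; cases "j \<in> {0, 1, 3, 7}") simp_all
    then show ?thesis by simp
  qed simp
  have "oct_mult (split_emb x) (split_emb y) $ k = split_emb (split_prod x y) $ k" for k
  proof -
    have "oct_mult (split_emb x) (split_emb y) $ k =
        (\<Sum>i\<in>UNIV. \<Sum>j\<in>UNIV. oct_coeff i j k * (u i * u j) * of_real (x $ i) * of_real (y $ j))"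
      unfolding oct_mult_def split_emb_nth vec_lambda_beta u_def[symmetric]
      by (intro sum.cong refl) (simp only: mult_ac)
    also have "\<dots> = (\<Sum>i\<in>UNIV. \<Sum>j\<in>UNIV.
        of_real (oct_coeff i j k * x $ i * y $ j * s i j) * u k)"
      unfolding unit by (intro sum.cong refl) (simp only: of_real_mult of_real_oct_coeff mult_ac)
    also have "\<dots> = of_real (split_prod x y $ k) * u k"
      unfolding split_prod_def vec_lambda_beta s_def[symmetric]
      by (simp only: of_real_sum sum_distrib_right)
    finally show ?thesis unfolding split_emb_nth u_def .
  qed
  then show ?thesis by (simp add: vec_eq_iff)
qed

lemma split_mult_eq: "x \<cdot>\<^sub>s y = split_prod x y"
  unfolding split_mult_def oct_mult_split_emb by (simp add: inv_f_f inj_split_emb)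

lemma split_emb_mult: "split_emb (x \<cdot>\<^sub>s y) = oct_mult (split_emb x) (split_emb y)"
  unfolding split_mult_eq oct_mult_split_emb ..

lemma oct_cyclic_asym:
  assumes "oct_cyclic i j k"
  shows "\<not> oct_cyclic j i k"
proof -
  have *: "\<forall>(a, b, c) \<in> oct_lines. \<not> oct_cyclic b a c \<and> \<not> oct_cyclic c b a \<and> \<not> oct_cyclic a c b"
    unfolding oct_lines_def oct_cyclic_def by simp
  have "\<not> oct_cyclic b a c" "\<not> oct_cyclic c b a" "\<not> oct_cyclic a c b" if "(a, b, c) \<in> oct_lines" for a b c
    using bspec[OF * that] by simp_all
  then show ?thesis using assms unfolding oct_cyclic_def[of i j k] by metis
qed

lemma split_mult_conj_real: "\<exists>r. x \<cdot>\<^sub>s split_conj x = r *\<^sub>R fb 0"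
proof -
  have "(x \<cdot>\<^sub>s split_conj x) $ k = 0" if k: "k \<noteq> 0" for k
  proof -
    define t where "t i j = oct_coeff i j k * x $ i * split_conj x $ j *
      (if i \<notin> {0, 1, 3, 7} \<and> j \<notin> {0, 1, 3, 7} then - 1 else 1)" for i j
    have "t i j = - t j i" for i j
    proof (cases "i = 0 \<or> j = 0 \<or> i = j")
      case True
      then show ?thesis using k by (elim disjE) (simp_all add: t_def oct_coeff_def split_conj_def)
    next
      case False
      then have "oct_coeff i j k = (- oct_coeff j i k :: real)"
        using k oct_cyclic_asym[of i j k] by (auto simp: oct_coeff_def)
      then show ?thesis
        using False by (simp add: t_def split_conj_def)
    qed
    then have "(\<Sum>i\<in>UNIV. \<Sum>j\<in>UNIV. t i j) = - (\<Sum>i\<in>UNIV. \<Sum>j\<in>UNIV. t j i)"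
      unfolding sum_negf[symmetric] by (intro sum.cong refl)
    also have "(\<Sum>i\<in>UNIV. \<Sum>j\<in>UNIV. t j i) = (\<Sum>i\<in>UNIV. \<Sum>j\<in>UNIV. t i j)"
      by (rule sum.swap)
    finally show ?thesis unfolding split_mult_eq split_prod_def t_def by simp
  qed
  then have "x \<cdot>\<^sub>s split_conj x = (x \<cdot>\<^sub>s split_conj x) $ 0 *\<^sub>R fb 0"
    by (simp add: vec_eq_iff axis_def)
  then show ?thesis ..
qed

lemma split_mult_conj: "x \<cdot>\<^sub>s split_conj x = split_norm x *\<^sub>R fb 0"
proof -
  have "\<exists>!r. x \<cdot>\<^sub>s split_conj x = r *\<^sub>R fb 0"
    using split_mult_conj_real[of x] by auto
  then show ?thesis unfolding split_norm_def by (rule theI')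
qed

text \<open>
  Vectors \<open>(x\<^sub>1, x\<^sub>2, x\<^sub>3; \<lambda>\<^sub>1, \<lambda>\<^sub>2, \<lambda>\<^sub>3)\<close>; the three algebras share the underlying space
  \<open>split_oct\<close> and the norm, so the ambient space and \<open>\<beta>\<close> do not depend on the algebra.
\<close>

type_synonym veronese_space = "(split_oct ^ 3) \<times> (real ^ 3)"

definition norm_conditions :: "veronese_space \<Rightarrow> bool" where
  "norm_conditions v \<longleftrightarrow> (case v of (x, l) \<Rightarrow>
     split_norm (x $ 1) = l $ 2 * l $ 3 \<and>
     split_norm (x $ 2) = l $ 3 * l $ 1 \<and>
     split_norm (x $ 3) = l $ 1 * l $ 2)"

definition veronese_oct :: "veronese_space \<Rightarrow> bool" where
  "veronese_oct v \<longleftrightarrow> v \<noteq> 0 \<and> (case v of (x, l) \<Rightarrow>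
     l $ 1 *\<^sub>R split_conj (x $ 1) = x $ 2 \<cdot>\<^sub>s x $ 3 \<and>
     l $ 2 *\<^sub>R split_conj (x $ 2) = x $ 3 \<cdot>\<^sub>s x $ 1 \<and>
     l $ 3 *\<^sub>R split_conj (x $ 3) = x $ 1 \<cdot>\<^sub>s x $ 2) \<and> norm_conditions v"

text \<open>
  The conditions for the symmetric composition algebras, with \<open>m\<close> standing for \<open>para_mult\<close>
  or \<open>okubo_mult\<close>.
\<close>

definition veronese_sym :: "(split_oct \<Rightarrow> split_oct \<Rightarrow> split_oct) \<Rightarrow> veronese_space \<Rightarrow> bool" where
  "veronese_sym m v \<longleftrightarrow> v \<noteq> 0 \<and> (case v of (x, l) \<Rightarrow>
     l $ 1 *\<^sub>R x $ 1 = m (x $ 2) (x $ 3) \<and>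
     l $ 2 *\<^sub>R x $ 2 = m (x $ 3) (x $ 1) \<and>
     l $ 3 *\<^sub>R x $ 3 = m (x $ 1) (x $ 2)) \<and> norm_conditions v"

definition veronese_beta :: "veronese_space \<Rightarrow> veronese_space \<Rightarrow> real" where
  "veronese_beta v w = (case (v, w) of ((x, l), (y, m)) \<Rightarrow>
     \<Sum>\<nu>\<in>UNIV. split_polar (x $ \<nu>) (y $ \<nu>) + l $ \<nu> * m $ \<nu>)"

record ('p, 'l) incidence_plane =
  points :: "'p set"
  lines :: "'l set"
  incident :: "'p \<Rightarrow> 'l \<Rightarrow> bool"

definition plane_isomorphic ::
  "('p, 'l) incidence_plane \<Rightarrow> ('q, 'm) incidence_plane \<Rightarrow> bool"  (infix \<open>\<cong>\<^sub>P\<close> 50) where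
  "P \<cong>\<^sub>P Q \<longleftrightarrow> (\<exists>g h. bij_betw g (points P) (points Q) \<and> bij_betw h (lines P) (lines Q) \<and>
     (\<forall>p\<in>points P. \<forall>l\<in>lines P. incident P p l \<longleftrightarrow> incident Q (g p) (h l)))"

definition veronese_plane ::
  "(veronese_space \<Rightarrow> bool) \<Rightarrow> (veronese_space set, veronese_space set) incidence_plane" where
  "veronese_plane ver =
     \<lparr> points = {span {w} |w. ver w},
       lines = {{z. veronese_beta z w = 0} |w. ver w},
       incident = (\<lambda>p l. p \<subseteq> l) \<rparr>"

definition split_oct_plane :: "(veronese_space set, veronese_space set) incidence_plane" where
  "split_oct_plane = veronese_plane veronese_oct"

definition split_para_plane :: "(veronese_space set, veronese_space set) incidence_plane" where
  "split_para_plane = veronese_plane (veronese_sym para_mult)"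

definition split_okubo_plane :: "(veronese_space set, veronese_space set) incidence_plane" where
  "split_okubo_plane = veronese_plane (veronese_sym okubo_mult)"

end

theory Submission
  imports Defs
begin

text \<open>All three planes live in the same space with the same form \<open>veronese_beta\<close>,
  so a linear bijection that preserves this form and matches the Veronese vectors carries points to
  points, lines to lines and incidence to incidence (\<open>veronese_plane_isomorphic\<close>).
  Norm-preserving linear bijections in the octonion coordinates, with the real coordinates fixed,
  suffice (\<open>coordinatewise_plane_isomorphic\<close>). From \<open>split_para_plane\<close> to
  \<open>split_oct_plane\<close>, conjugate every coordinate; from \<open>split_okubo_plane\<close>
  to \<open>split_para_plane\<close>, apply 1, \<open>tau\<close> and its square to the three
  coordinates, which works because \<open>tau\<close> is an automorphism of order three
  (\<open>tau_mult\<close>, \<open>tau_tau_tau\<close>).\<close>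

lemma UNIV_8: "(UNIV :: 8 set) = {0, 1, 2, 3, 4, 5, 6, 7}"
proof -
  have "card {0, 1, 2, 3, 4, 5, 6, 7 :: 8} = CARD(8)" by simp
  from card_subset_eq[OF finite subset_UNIV this] show ?thesis by (rule sym)
qed

lemma sum_8: "sum f (UNIV :: 8 set) = f 0 + f 1 + f 2 + f 3 + f 4 + f 5 + f 6 + f 7"
  unfolding UNIV_8 by (simp add: add.assoc)

lemma forall_8: "(\<forall>k::8. P k) \<longleftrightarrow> P 0 \<and> P 1 \<and> P 2 \<and> P 3 \<and> P 4 \<and> P 5 \<and> P 6 \<and> P 7"
proof -
  have "(\<forall>k. P k) \<longleftrightarrow> (\<forall>k\<in>UNIV. P k)" by simp
  then show ?thesis unfolding UNIV_8 by simp
qed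

text \<open>Expanding the product makes the algebraic facts about \<open>tau\<close> polynomial
  identities in coordinates.\<close>

lemma split_mult_nth:
  "(x \<cdot>\<^sub>s y) $ 0 = x$0*y$0 - x$1*y$1 + x$2*y$2 - x$3*y$3 + x$4*y$4 + x$5*y$5 + x$6*y$6 - x$7*y$7"
  "(x \<cdot>\<^sub>s y) $ 1 = x$0*y$1 + x$1*y$0 - x$2*y$4 + x$3*y$7 + x$4*y$2 - x$5*y$6 + x$6*y$5 - x$7*y$3"
  "(x \<cdot>\<^sub>s y) $ 2 = x$0*y$2 - x$1*y$4 + x$2*y$0 + x$3*y$5 + x$4*y$1 - x$5*y$3 + x$6*y$7 - x$7*y$6"
  "(x \<cdot>\<^sub>s y) $ 3 = x$0*y$3 - x$1*y$7 + x$2*y$5 + x$3*y$0 - x$4*y$6 - x$5*y$2 + x$6*y$4 + x$7*y$1"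
  "(x \<cdot>\<^sub>s y) $ 4 = x$0*y$4 + x$1*y$2 - x$2*y$1 - x$3*y$6 + x$4*y$0 + x$5*y$7 + x$6*y$3 - x$7*y$5"
  "(x \<cdot>\<^sub>s y) $ 5 = x$0*y$5 - x$1*y$6 + x$2*y$3 - x$3*y$2 - x$4*y$7 + x$5*y$0 + x$6*y$1 + x$7*y$4"
  "(x \<cdot>\<^sub>s y) $ 6 = x$0*y$6 + x$1*y$5 - x$2*y$7 + x$3*y$4 - x$4*y$3 - x$5*y$1 + x$6*y$0 + x$7*y$2"
  "(x \<cdot>\<^sub>s y) $ 7 = x$0*y$7 + x$1*y$3 - x$2*y$6 - x$3*y$1 - x$4*y$5 + x$5*y$4 + x$6*y$2 + x$7*y$0"
  unfolding split_mult_eq split_prod_def vec_lambda_beta sum_8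
  by (simp_all add: oct_coeff_def oct_cyclic_def oct_lines_def)

lemma split_conj_nth: "split_conj x $ k = (if k = 0 then x $ k else - x $ k)"
  by (simp add: split_conj_def)

lemma split_norm_eq: "split_norm x = (x \<cdot>\<^sub>s split_conj x) $ 0"
  by (simp add: split_mult_conj)

lemma split_norm_nth:
  "split_norm x = (x$0)\<^sup>2 + (x$1)\<^sup>2 - (x$2)\<^sup>2 + (x$3)\<^sup>2 - (x$4)\<^sup>2 - (x$5)\<^sup>2 - (x$6)\<^sup>2 + (x$7)\<^sup>2"
  unfolding split_norm_eq split_mult_nth split_conj_nth by (simp add: power2_eq_square)

lemma tau_nth:
  "tau x $ 0 = x $ 0" "tau x $ 1 = x $ 1" "tau x $ 3 = x $ 3" "tau x $ 7 = x $ 7"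
  "tau x $ 2 = - (x $ 2 + sqrt 3 * x $ 5) / 2" "tau x $ 5 = - (x $ 5 - sqrt 3 * x $ 2) / 2"
  "tau x $ 4 = - (x $ 4 + sqrt 3 * x $ 6) / 2" "tau x $ 6 = - (x $ 6 - sqrt 3 * x $ 4) / 2"
  unfolding tau_def sum_component vector_scaleR_component sum_8
  by (simp_all add: tau_basis_def axis_def field_simps)

lemma linear_tau: "linear tau"
  by (rule linearI)
    (simp_all add: tau_def scaleR_add_left sum.distrib scaleR_sum_right)

lemma linear_split_conj: "linear split_conj"
  by (rule linearI) (simp_all add: vec_eq_iff split_conj_nth)

lemma split_conj_conj: "split_conj (split_conj x) = x"
  by (simp add: vec_eq_iff split_conj_nth)

lemma split_norm_conj: "split_norm (split_conj x) = split_norm x"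
  by (simp add: split_norm_nth split_conj_nth)

lemma tau_split_conj: "tau (split_conj x) = split_conj (tau x)"
  by (simp add: vec_eq_iff forall_8 tau_nth split_conj_nth field_simps)

lemma tau_tau_tau: "tau (tau (tau x)) = x"
proof -
  \<comment> \<open>The only relation needed beyond ring arithmetic, in the right-nested shape that
    \<open>field_simps\<close> produces.\<close>
  have s: "sqrt 3 * (sqrt 3 * a) = 3 * a" for a :: real
    by (simp flip: mult.assoc)
  show ?thesis
    by (simp add: vec_eq_iff forall_8 tau_nth field_simps s)
qed

text \<open>\<open>tau\<close> fixes the quaternion subalgebra on indices 0, 1, 3, 7 and rotates the
  planes (2,5) and (4,6) by a third of a turn; multiplicativity is checked coordinate by
  coordinate.\<close>

lemma tau_mult: "tau (x \<cdot>\<^sub>s y) = tau x \<cdot>\<^sub>s tau y"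
proof -
  have s: "sqrt 3 * (sqrt 3 * a) = 3 * a" for a :: real
    by (simp flip: mult.assoc)
  show ?thesis
    unfolding vec_eq_iff forall_8 split_mult_nth tau_nth
    by (intro conjI) (simp_all add: field_simps s)
qed

text \<open>The norm is coordinate 0 of \<open>x \<cdot>\<^sub>s split_conj x\<close>;
  \<open>tau\<close> respects product and conjugation and fixes that coordinate.\<close>

lemma split_norm_tau: "split_norm (tau x) = split_norm x"
  unfolding split_norm_eq by (simp add: tau_nth flip: tau_split_conj tau_mult)

lemma split_polar_linear:
  assumes "linear f" "\<And>x. split_norm (f x) = split_norm x"
  shows "split_polar (f x) (f y) = split_polar x y"
  unfolding split_polar_def by (simp add: assms(2) flip: linear_add[OF assms(1)])

text \<open>One map serves both points and lines: a bijective isometry sends the orthogonal space of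
  \<open>w\<close> onto that of \<open>F w\<close>.\<close>

lemma veronese_plane_isomorphic:
  assumes lin: "linear F" and bij: "bij F"
    and ver: "\<And>w. ver' (F w) \<longleftrightarrow> ver w"
    and beta: "\<And>v w. veronese_beta (F v) (F w) = veronese_beta v w"
  shows "veronese_plane ver \<cong>\<^sub>P veronese_plane ver'"
proof -
  have inj: "inj ((`) F)"
    by (rule injI) (simp add: inj_image_eq_iff bij_is_inj[OF bij])
  have surj: "surj F" using bij by (rule bij_is_surj)
  \<comment> \<open>\<open>ver\<close> speaks only of vectors \<open>F w\<close>; surjectivity
    extends it to all vectors.\<close>
  have ver': "Collect ver' = F ` Collect ver"
  proof (intro equalityI subsetI)
    fix w assume "w \<in> Collect ver'"
    moreover obtain v where "w = F v" using surj by (rule surjE)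
    ultimately show "w \<in> F ` Collect ver" using ver by simp
  next
    fix w assume "w \<in> F ` Collect ver"
    then show "w \<in> Collect ver'" by (elim imageE) (simp add: ver)
  qed
  have span: "span {F w} = F ` span {w}" for w
    using linear_span_image[OF lin, of "{w}"] by simp
  have perp: "{z. veronese_beta z (F w) = 0} = F ` {z. veronese_beta z w = 0}" for w
  proof (intro equalityI subsetI)
    fix z assume "z \<in> {z. veronese_beta z (F w) = 0}"
    moreover obtain v where "z = F v" using surj by (rule surjE)
    ultimately show "z \<in> F ` {z. veronese_beta z w = 0}" using beta by simp
  next
    fix z assume "z \<in> F ` {z. veronese_beta z w = 0}"
    then show "z \<in> {z. veronese_beta z (F w) = 0}"
      by (elim imageE) (simp add: beta)
  qed
  have points: "points (veronese_plane ver') = (`) F ` points (veronese_plane ver)"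
    unfolding veronese_plane_def incidence_plane.select_convs setcompr_eq_image ver' image_image span ..
  have lines: "lines (veronese_plane ver') = (`) F ` lines (veronese_plane ver)"
    unfolding veronese_plane_def incidence_plane.select_convs setcompr_eq_image ver' image_image perp ..
  have "incident (veronese_plane ver) p l \<longleftrightarrow> incident (veronese_plane ver') (F ` p) (F ` l)" for p l
    by (simp add: veronese_plane_def inj_image_subset_iff bij_is_inj[OF bij])
  then show ?thesis
    unfolding plane_isomorphic_def points lines
    using inj_on_imp_bij_betw[OF inj_on_subset[OF inj subset_UNIV]] by blast
qed

text \<open>The map may vary with the index, since the Okubo case needs a different power of
  \<open>tau\<close> in each coordinate.\<close>

definition coordinatewise :: "(3 \<Rightarrow> split_oct \<Rightarrow> split_oct) \<Rightarrow> veronese_space \<Rightarrow> veronese_space" where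
  "coordinatewise f = (\<lambda>(x, l). (\<chi> \<nu>. f \<nu> (x $ \<nu>), l))"

text \<open>Preserving the norm preserves its polarization, hence \<open>veronese_beta\<close>; only
  the Veronese equations remain to be compared.\<close>

lemma coordinatewise_plane_isomorphic:
  assumes lin: "\<And>\<nu>. linear (f \<nu>)" and bij: "\<And>\<nu>. bij (f \<nu>)"
    and norm: "\<And>\<nu> x. split_norm (f \<nu> x) = split_norm x"
    and ver: "\<And>w. ver' (coordinatewise f w) \<longleftrightarrow> ver w"
  shows "veronese_plane ver \<cong>\<^sub>P veronese_plane ver'"
proof (rule veronese_plane_isomorphic[where F = "coordinatewise f"])
  show "linear (coordinatewise f)"
    by (rule linearI) (auto simp: coordinatewise_def vec_eq_iff
        linear_add[OF lin] linear_scale[OF lin])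
  show "bij (coordinatewise f)"
    by (rule bij_betw_byWitness[where f' = "coordinatewise (\<lambda>\<nu>. inv (f \<nu>))"])
      (auto simp: coordinatewise_def vec_eq_iff bij bij_is_inj bij_is_surj surj_f_inv_f)
  show "veronese_beta (coordinatewise f v) (coordinatewise f w) = veronese_beta v w" for v w
    by (auto simp: coordinatewise_def veronese_beta_def split_polar_linear[OF lin norm]
        split: prod.split)
qed (rule ver)

lemma coordinatewise_eq_0_iff:
  assumes "\<And>\<nu>. linear (f \<nu>)" "\<And>\<nu>. bij (f \<nu>)"
  shows "coordinatewise f w = 0 \<longleftrightarrow> w = 0"
proof -
  have "f \<nu> x = 0 \<longleftrightarrow> x = 0" for \<nu> x
    using assms by (metis bij_is_inj linear_injective_0 linear_0)
  then show ?thesis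
    by (cases w) (auto simp: coordinatewise_def vec_eq_iff zero_prod_def)
qed

lemma norm_conditions_coordinatewise:
  assumes "\<And>\<nu> x. split_norm (f \<nu> x) = split_norm x"
  shows "norm_conditions (coordinatewise f w) \<longleftrightarrow> norm_conditions w"
  using assms by (auto simp: norm_conditions_def coordinatewise_def split: prod.split)

lemma bij_split_conj: "bij split_conj"
  by (rule involuntory_imp_bij) (rule split_conj_conj)

lemma bij_tau: "bij tau"
  by (rule bij_betw_byWitness[where f' = "tau \<circ> tau"]) (auto simp: tau_tau_tau)

text \<open>Substituting conjugates cancels the conjugation on the left of each octonionic equation
  and puts one on each factor on the right, which is \<open>para_mult\<close>.\<close>

lemma split_para_plane_isomorphic_oct: "split_para_plane \<cong>\<^sub>P split_oct_plane"
  unfolding split_para_plane_def split_oct_plane_def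
proof (rule coordinatewise_plane_isomorphic[where f = "\<lambda>_. split_conj"])
  fix w
  show "veronese_oct (coordinatewise (\<lambda>_. split_conj) w) \<longleftrightarrow> veronese_sym para_mult w"
    unfolding veronese_oct_def veronese_sym_def
      coordinatewise_eq_0_iff[OF linear_split_conj bij_split_conj]
      norm_conditions_coordinatewise[OF split_norm_conj]
    by (simp add: coordinatewise_def para_mult_def split_conj_conj split: prod.split)
qed (rule linear_split_conj bij_split_conj split_norm_conj)+

text \<open>
  The powers of \<open>\<tau>\<close> are forced by the exponents in
  \<open>\<lambda>\<^sub>1 x\<^sub>1 = \<tau>(conj x\<^sub>2) \<cdot> \<tau>\<^sup>2(conj x\<^sub>3)\<close> and its cyclic shifts: replacing \<open>x\<^sub>\<nu>\<close> by \<open>\<tau>\<^sup>\<nu>\<^sup>-\<^sup>1 x\<^sub>\<nu>\<close>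
  removes all of them, since \<open>\<tau>\<^sup>3 = 1\<close>.
\<close>

definition tau_twist :: "3 \<Rightarrow> split_oct \<Rightarrow> split_oct" where
  "tau_twist \<nu> = (if \<nu> = 1 then id else if \<nu> = 2 then tau else tau \<circ> tau)"

lemma tau_eq_iff: "tau x = tau y \<longleftrightarrow> x = y"
  using bij_tau by (simp add: bij_is_inj inj_eq)

lemma split_okubo_plane_isomorphic_para: "split_okubo_plane \<cong>\<^sub>P split_para_plane"
  unfolding split_okubo_plane_def split_para_plane_def
proof (rule coordinatewise_plane_isomorphic[where f = tau_twist])
  show lin: "linear (tau_twist \<nu>)" for \<nu>
    using linear_tau linear_compose[OF linear_tau linear_tau] by (simp add: tau_twist_def linear_id)
  show bij: "bij (tau_twist \<nu>)" for \<nu>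
    using bij_tau bij_comp[OF bij_tau bij_tau] by (simp add: tau_twist_def)
  show norm: "split_norm (tau_twist \<nu> x) = split_norm x" for \<nu> x
    by (simp add: tau_twist_def split_norm_tau)
  fix w
  obtain x :: "split_oct ^ 3" and l :: "real ^ 3" where w: "w = (x, l)" by (cases w)
  \<comment> \<open>The twisted second equation is \<open>tau\<close> of the Okubo one: the
    exponents (1,2) become (2,3), and the cube is trivial.\<close>
  have "l $ 2 *\<^sub>R tau (x $ 2) = para_mult (tau (tau (x $ 3))) (x $ 1) \<longleftrightarrow>
      tau (l $ 2 *\<^sub>R x $ 2) = tau (okubo_mult (x $ 3) (x $ 1))"
    by (simp add: para_mult_def okubo_mult_def linear_scale[OF linear_tau] tau_mult
        tau_split_conj tau_tau_tau)
  then have 2: "l $ 2 *\<^sub>R tau (x $ 2) = para_mult (tau (tau (x $ 3))) (x $ 1) \<longleftrightarrow>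
      l $ 2 *\<^sub>R x $ 2 = okubo_mult (x $ 3) (x $ 1)"
    unfolding tau_eq_iff .
  \<comment> \<open>Here \<open>tau\<close> is applied twice, turning (1,2) into (3,4), that is
    (0,1).\<close>
  have "l $ 3 *\<^sub>R tau (tau (x $ 3)) = para_mult (x $ 1) (tau (x $ 2)) \<longleftrightarrow>
      tau (tau (l $ 3 *\<^sub>R x $ 3)) = tau (tau (okubo_mult (x $ 1) (x $ 2)))"
    by (simp add: para_mult_def okubo_mult_def linear_scale[OF linear_tau] tau_mult
        tau_split_conj tau_tau_tau)
  then have 3: "l $ 3 *\<^sub>R tau (tau (x $ 3)) = para_mult (x $ 1) (tau (x $ 2)) \<longleftrightarrow>
      l $ 3 *\<^sub>R x $ 3 = okubo_mult (x $ 1) (x $ 2)"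
    unfolding tau_eq_iff .
  show "veronese_sym para_mult (coordinatewise tau_twist w) \<longleftrightarrow> veronese_sym okubo_mult w"
    unfolding veronese_sym_def coordinatewise_eq_0_iff[OF lin bij]
      norm_conditions_coordinatewise[OF norm]
    by (simp add: w coordinatewise_def tau_twist_def 2 3)
      \<comment> \<open>The first equation already has exponents (1,2), so commuting
        \<open>tau\<close> with conjugation is enough.\<close>
      (simp add: para_mult_def okubo_mult_def tau_split_conj)
qed

theorem mainTheorem1:
  shows "split_okubo_plane \<cong>\<^sub>P split_para_plane \<and> split_para_plane \<cong>\<^sub>P split_oct_plane"
  using split_okubo_plane_isomorphic_para split_para_plane_isomorphic_oct ..

end
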